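(* Let $p$ be a prime, let $a\in\mathbb{C}_p$ with $a\neq 0$, let $f(x)=\frac{a}{x^2}$ for $x\in\mathbb{C}_p\setminus\{0\}$, let $\alpha=(|a|_p)^{1/3}$, and let $x_1,x_2,x_3$ be the three fixed points of $f$ (the solutions of $x^3=a$ in $\mathbb{C}_p$). For the dynamical system generated by $f:S_\alpha(0)\to S_\alpha(0)$ the following hold. 1. If $p=2$, then for each $j\in\{1,2,3\}$, $\mathcal{A}(x_j)=\mathcal{V}_{\alpha,x_j}$, i.e. $\lim_{n\to\infty}f^n(x)=x_j$ for any $x\in\mathcal{V}_{\alpha,x_j}$; and $f^n(x)\in\mathcal{U}_\alpha$ for all $n\geq 1$ and all $x\in\mathcal{U}_\alpha$. 2. If $p\geq 3$, then $SI(x_j)=\mathcal{V}_{\alpha,x_j}$ for $j\in\{1,2,3\}$. Moreover, $SI(x_1)=SI(x_2)=SI(x_3)$ if $p=3$, and $SI(x_j)\cap SI(x_k)=\emptyset$ for $j\neq k$ if $p>3$. 3. If $p\geq 3$ and $x\in\mathcal{U}_\alpha$, then one of the following assertions holds: a) there exist an integer $n_0\geq 0$, a real number $\mu_{n_0}$ with $0\le \mu_{n_0}<\alpha$, and $i\in\{1,2,3\}$ such that $f^n(x)\in\mathcal{U}_\alpha$ for all $n\leq n_0$ and $f^n(x)\in\mathcal{S}_{\mu_{n_0},x_i}$ for all $n>n_0$; b) $f^n(x)\in\mathcal{U}_\alpha$ for all $n\geq 1$.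
   Context: $\mathbb{C}_p$ is the field of complex $p$-adic numbers (the completion of the algebraic closure of $\mathbb{Q}_p$) with the $p$-adic norm $|\cdot|_p$ normalized by $|p|_p=1/p$. For $c\in\mathbb{C}_p$ and $r>0$: $U_r(c)=\{x:|x-c|_p<r\}$, $S_r(c)=\{x:|x-c|_p=r\}$. $f^n$ is the $n$-fold composition of $f$ ($f^0$ is the identity); $f$ maps $\mathbb{C}_p\setminus\{0\}$ to itself and $S_\alpha(0)$ to itself, and $x_1,x_2,x_3\in S_\alpha(0)$. For $t\in S_\alpha(0)$ and $\rho\geq 0$: $\mathcal{S}_{\rho,t}=\{x\in S_\alpha(0):|x-t|_p=\rho\}$, and for $\rho>0$: $\mathcal{V}_{\rho,t}=\bigcup_{0\leq r<\rho}\mathcal{S}_{r,t}=\{x\in S_\alpha(0):|x-t|_p<\rho\}$. Also $\mathcal{U}_\alpha=\{x\in S_\alpha(0):|x-x_1|_p=|x-x_2|_p=|x-x_3|_p=\alpha\}$. The basin of attraction of an attracting fixed point $x_0$ is $\mathcal{A}(x_0)=\{x\in\mathbb{C}_p\setminus\{0\}: f^n(x)\to x_0,\ n\to\infty\}$. A ball $U_r(x_0)$ around a fixed point $x_0$, contained in the domain $\mathbb{C}_p\setminus\{0\}$ of $f$, is a Siegel disk if each sphere $S_\rho(x_0)$, $\rho<r$, is invariant under $f$, i.e. $x\in S_\rho(x_0)$ implies $f^n(x)\in S_\rho(x_0)$ for all $n\geq 1$. The maximum Siegel disk $SI(x_0)$ is the union of all Siegel disks centered at $x_0$. *)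

theory Defs
  imports "HOL-Analysis.Analysis" "HOL-Computational_Algebra.Computational_Algebra"
begin

text \<open>
  The \<open>p\<close>-adic absolute value on the rationals, \<open>p\<close> to the power \<open>v(d) - v(c)\<close> for a nonzero
  fraction \<open>c / d\<close>, where \<open>v\<close> is the exponent of \<open>p\<close>.
\<close>
definition padic_abs_rat :: "nat \<Rightarrow> rat \<Rightarrow> real" where
  "padic_abs_rat p q =
     (if q = 0 then 0
      else case quotient_of q of (c, d) \<Rightarrow>
        real p powi (int (multiplicity (int p) d) - int (multiplicity (int p) c)))"

definition algebraic_over :: "'a::field set \<Rightarrow> 'a \<Rightarrow> bool" where
  "algebraic_over F z \<longleftrightarrow> (\<exists>P. P \<noteq> 0 \<and> (\<forall>i. coeff P i \<in> F) \<and> poly P z = 0)"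

definition algebraically_closed_set :: "'a::field set \<Rightarrow> bool" where
  "algebraically_closed_set F \<longleftrightarrow>
     (\<forall>P. (\<forall>i. coeff P i \<in> F) \<and> degree P > 0 \<longrightarrow> (\<exists>z\<in>F. poly P z = 0))"

text \<open>
  A complex \<open>p\<close>-adic field is a completion of an algebraic closure of a completion of the rationals
  with respect to the \<open>p\<close>-adic absolute value. It is unique up to isometric isomorphism, so it is
  described here by this property of a type. The completion of the rationals
  is realised as their closure in the complete space \<open>'a\<close>. Completeness is the class
  \<open>complete_space\<close>. The constant \<open>norm\<close> is reserved for real normed vector spaces, which these
  fields are not; hence the absolute value is written as the distance from \<open>0\<close>.
\<close>

definition padic_norm :: "'a::{field_char_0, complete_space} \<Rightarrow> real" where
  "padic_norm z = dist z 0"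

definition padic_numbers :: "'a::{field_char_0, complete_space} set" where
  "padic_numbers = closure \<rat>"

definition padic_algebraic_numbers :: "'a::{field_char_0, complete_space} set" where
  "padic_algebraic_numbers = {z. algebraic_over padic_numbers z}"

definition complex_padic_field :: "nat \<Rightarrow> 'a::{field_char_0, complete_space} itself \<Rightarrow> bool" where
  "complex_padic_field p (K :: 'a itself) \<longleftrightarrow>
     prime p \<and>
     (\<forall>y z :: 'a. dist y z = padic_norm (y - z)) \<and>
     (\<forall>y z :: 'a. padic_norm (y * z) = padic_norm y * padic_norm z) \<and>
     (\<forall>y z :: 'a. padic_norm (y + z) \<le> max (padic_norm y) (padic_norm z)) \<and>
     (\<forall>q. padic_norm (of_rat q :: 'a) = padic_abs_rat p q) \<and>
     algebraically_closed_set (padic_algebraic_numbers :: 'a set) \<and>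
     closure (padic_algebraic_numbers :: 'a set) = UNIV"

lemma padic_norm_p:
  assumes "complex_padic_field p TYPE('a::{field_char_0, complete_space})"
  shows "padic_norm (of_nat p :: 'a) = 1 / real p"
proof -
  have "padic_norm (of_rat (of_nat p) :: 'a) = padic_abs_rat p (of_nat p)"
    using assms unfolding complex_padic_field_def by blast
  moreover have "prime p"
    using assms unfolding complex_padic_field_def by blast
  ultimately show ?thesis
    by (auto simp: padic_abs_rat_def power_int_minus field_simps)
qed

text \<open>
  Since \<open>a / 0 = 0\<close>, the value at \<open>0\<close> is junk; the notions below exclude \<open>0\<close> explicitly.
\<close>
definition inv_square_map :: "'a::field \<Rightarrow> 'a \<Rightarrow> 'a" where
  "inv_square_map a x = a / x ^ 2"

definition sphere_at :: "real \<Rightarrow> real \<Rightarrow> 'a::{field_char_0, complete_space} \<Rightarrow> 'a set"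
  where "sphere_at \<alpha> \<rho> t = {x \<in> sphere 0 \<alpha>. padic_norm (x - t) = \<rho>}"

definition disc_at :: "real \<Rightarrow> real \<Rightarrow> 'a::{field_char_0, complete_space} \<Rightarrow> 'a set"
  where "disc_at \<alpha> \<rho> t = (\<Union>r\<in>{0..<\<rho>}. sphere_at \<alpha> r t)"

lemma disc_at_eq: "disc_at \<alpha> \<rho> t = {x \<in> sphere 0 \<alpha>. padic_norm (x - t) < \<rho>}"
  by (auto simp: disc_at_def sphere_at_def padic_norm_def)

definition remote_part ::
    "real \<Rightarrow> (nat \<Rightarrow> 'a) \<Rightarrow> 'a::{field_char_0, complete_space} set" where
  "remote_part \<alpha> xs =
     {x \<in> sphere 0 \<alpha>. padic_norm (x - xs 1) = \<alpha> \<and> padic_norm (x - xs 2) = \<alpha> \<and> padic_norm (x - xs 3) = \<alpha>}"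

definition basin :: "('a \<Rightarrow> 'a) \<Rightarrow> 'a \<Rightarrow> 'a::{field_char_0, complete_space} set" where
  "basin g x0 = {x. x \<noteq> 0 \<and> (\<lambda>n. (g ^^ n) x) \<longlonglongrightarrow> x0}"

definition siegel_disk ::
    "('a \<Rightarrow> 'a) \<Rightarrow> 'a \<Rightarrow> 'a::{field_char_0, complete_space} set \<Rightarrow> bool" where
  "siegel_disk g x0 D \<longleftrightarrow>
     x0 \<noteq> 0 \<and> g x0 = x0 \<and>
     (\<exists>r>0. D = ball x0 r \<and> D \<subseteq> UNIV - {0} \<and>
        (\<forall>\<rho><r. \<forall>x\<in>sphere x0 \<rho>. \<forall>n\<ge>1. (g ^^ n) x \<in> sphere x0 \<rho>))"

definition max_siegel_disk ::
    "('a \<Rightarrow> 'a) \<Rightarrow> 'a \<Rightarrow> 'a::{field_char_0, complete_space} set" where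
  "max_siegel_disk g x0 = \<Union>{D. siegel_disk g x0 D}"

end

theory Submission imports Defs begin

text \<open>
  Let \<open>x0\<close> be a fixed point of \<open>f x = a / x^2\<close>, so \<open>a = x0^3\<close> and \<open>\<bar>x0\<bar> = \<alpha>\<close>. Everything rests on
  the factorisation \<open>f x - x0 = - x0 (x - x0) (x + x0) / x^2\<close>: on the sphere \<open>\<bar>x\<bar> = \<alpha>\<close>, one step
  multiplies the distance to \<open>x0\<close> by \<open>\<bar>x + x0\<bar> / \<alpha>\<close> (\<open>dist_inv_square_map\<close>). Since
  \<open>x + x0 = (x - x0) + 2 x0\<close>, the ultrametric inequality determines this factor from \<open>\<bar>2\<bar>\<close>.

  If \<open>p = 2\<close> then \<open>\<bar>2\<bar> = 1/2\<close>. For \<open>\<bar>x - x0\<bar> < \<alpha>\<close> the factor is at most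
  \<open>max (\<bar>x - x0\<bar> / \<alpha>) (1/2) < 1\<close>, and this bound does not increase along the orbit, so the orbit converges geometrically
  (\<open>even_contraction\<close>). For \<open>\<bar>x - x0\<bar> = \<alpha>\<close> the factor is \<open>1\<close>, so the orbit stays at distance \<open>\<alpha>\<close>
  (\<open>even_far_step\<close>). Points off the sphere never enter it, because \<open>\<bar>f x\<bar> = \<alpha>\<close> forces \<open>\<bar>x\<bar> = \<alpha>\<close>.
  Hence the basin is exactly the disc.

  If \<open>p \<ge> 3\<close> then \<open>\<bar>2\<bar> = 1\<close>, and the factor is \<open>1\<close> on the whole disc \<open>\<bar>x - x0\<bar> < \<alpha>\<close>, which is
  therefore a Siegel disk (\<open>odd_near_step\<close>). No larger ball around \<open>x0\<close> avoids \<open>0\<close>, which lies at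
  distance \<open>\<alpha>\<close>. Two of these discs coincide or are disjoint according to the distance of their
  centres, and distinct roots of \<open>x^3 = a\<close> satisfy \<open>(y - z)^2 = - 3 y z\<close>, so this distance is \<open>\<alpha>\<close>
  times the square root of \<open>\<bar>3\<bar>\<close> (\<open>dist_fixed_points\<close>). A point that leaves the remote part stays
  on the sphere of radius \<open>\<alpha>\<close>, hence lands in one of the discs, where its distance to the centre
  never changes again.
\<close>

section \<open>The absolute value of a complex p-adic field\<close>

lemma padic_norm_nonneg: "0 \<le> padic_norm z"
  by (simp add: padic_norm_def)

lemma padic_norm_eq_0_iff: "padic_norm z = 0 \<longleftrightarrow> z = 0"
  by (simp add: padic_norm_def)

lemma mem_sphere_0_iff: "z \<in> sphere 0 r \<longleftrightarrow> padic_norm z = r"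
  by (simp add: padic_norm_def dist_commute)

lemma mem_disc_at_iff:
  "x \<in> disc_at \<alpha> \<rho> t \<longleftrightarrow> padic_norm x = \<alpha> \<and> padic_norm (x - t) < \<rho>"
  by (simp add: disc_at_eq mem_sphere_0_iff del: mem_sphere)

context
  fixes p :: nat
  assumes field: "complex_padic_field p TYPE('a::{field_char_0, complete_space})"
begin

lemma dist_eq_padic_norm: "dist (y::'a) z = padic_norm (y - z)"
  using field unfolding complex_padic_field_def by blast

lemma padic_norm_mult: "padic_norm ((y::'a) * z) = padic_norm y * padic_norm z"
  using field unfolding complex_padic_field_def by blast

lemma padic_norm_add_le: "padic_norm ((y::'a) + z) \<le> max (padic_norm y) (padic_norm z)"
  using field unfolding complex_padic_field_def by blast

lemma padic_norm_of_rat: "padic_norm (of_rat q :: 'a) = padic_abs_rat p q"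
  using field unfolding complex_padic_field_def by blast

lemma padic_norm_minus: "padic_norm (- (z::'a)) = padic_norm z"
  using dist_eq_padic_norm[of 0 z] by (simp add: padic_norm_def dist_commute)

lemma padic_norm_diff_commute: "padic_norm ((y::'a) - z) = padic_norm (z - y)"
  using padic_norm_minus[of "y - z"] by simp

lemma mem_sphere_iff: "(x::'a) \<in> sphere t r \<longleftrightarrow> padic_norm (x - t) = r"
  unfolding mem_sphere dist_eq_padic_norm padic_norm_diff_commute[of t x] ..

lemma padic_norm_diff_le: "padic_norm ((y::'a) - z) \<le> max (padic_norm y) (padic_norm z)"
  using padic_norm_add_le[of y "- z"] by (simp add: padic_norm_minus)

lemma padic_norm_add_dominant:
  assumes "padic_norm (y::'a) < padic_norm z"
  shows "padic_norm (y + z) = padic_norm z"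
  using padic_norm_add_le[of y z] padic_norm_diff_le[of "y + z" y] assms by simp

lemma padic_norm_1: "padic_norm (1::'a) = 1"
  using padic_norm_mult[of 1 1] padic_norm_eq_0_iff[of "1::'a"] by simp

lemma padic_norm_power: "padic_norm ((z::'a) ^ n) = padic_norm z ^ n"
  by (induction n) (simp_all add: padic_norm_1 padic_norm_mult)

lemma padic_norm_divide: "padic_norm ((y::'a) / z) = padic_norm y / padic_norm z"
proof (cases "z = 0")
  case False
  then show ?thesis
    using padic_norm_mult[of "y / z" z] padic_norm_eq_0_iff[of z] by (simp add: field_simps)
qed (simp add: padic_norm_def)

lemma padic_norm_of_nat_unit:
  assumes "\<not> p dvd m"
  shows "padic_norm (of_nat m :: 'a) = 1"
proof -
  have "m \<noteq> 0" using assms by (rule contrapos_nn) simp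
  moreover have "multiplicity (int p) (int m) = 0"
    using assms by (intro not_dvd_imp_multiplicity_0) simp
  moreover have "quotient_of (of_nat m) = (int m, 1)"
    using quotient_of_int[of "int m"] by simp
  ultimately have "padic_abs_rat p (of_nat m) = 1"
    by (simp add: padic_abs_rat_def)
  then show ?thesis
    using padic_norm_of_rat[of "of_nat m"] by simp
qed

lemma padic_norm_prime_unit:
  assumes "prime q" and "q \<noteq> p"
  shows "padic_norm (of_nat q :: 'a) = 1"
proof (rule padic_norm_of_nat_unit)
  have "prime p" using field unfolding complex_padic_field_def by blast
  then show "\<not> p dvd q" using assms primes_dvd_imp_eq by blast
qed

section \<open>One step of the map\<close>

context
  fixes a :: 'a and \<alpha> :: real
  assumes a_nz: "a \<noteq> 0" and \<alpha>_eq: "\<alpha> = padic_norm a powr (1 / 3)"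
begin

private abbreviation (input) f :: "'a \<Rightarrow> 'a" where "f \<equiv> inv_square_map a"

lemma \<alpha>_pos: "0 < \<alpha>"
  using a_nz padic_norm_eq_0_iff[of a] by (simp add: \<alpha>_eq)

lemma padic_norm_a: "padic_norm a = \<alpha> ^ 3"
proof -
  have "0 < padic_norm a"
    using a_nz padic_norm_eq_0_iff[of a] padic_norm_nonneg[of a] by simp
  then show ?thesis by (simp add: \<alpha>_eq powr_power)
qed

lemma norm_inv_square_map: "padic_norm (f x) = \<alpha> ^ 3 / padic_norm x ^ 2"
  by (simp add: inv_square_map_def padic_norm_divide padic_norm_power padic_norm_a)

lemma norm_inv_square_map_eq_iff: "padic_norm (f x) = \<alpha> \<longleftrightarrow> padic_norm x = \<alpha>"
proof (cases "x = 0")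
  case True
  then show ?thesis
    using \<alpha>_pos by (simp add: inv_square_map_def padic_norm_def)
next
  case False
  then have pos: "0 < padic_norm x"
    using padic_norm_nonneg[of x] padic_norm_eq_0_iff[of x] by simp
  then have "padic_norm (f x) = \<alpha> \<longleftrightarrow> padic_norm x ^ 2 = \<alpha> ^ 2"
    using \<alpha>_pos by (auto simp: norm_inv_square_map field_simps power3_eq_cube power2_eq_square)
  also have "\<dots> \<longleftrightarrow> padic_norm x = \<alpha>"
    using pos \<alpha>_pos by (intro power2_eq_iff_nonneg) simp_all
  finally show ?thesis .
qed

lemma norm_orbit_eq_iff: "padic_norm ((f ^^ n) x) = \<alpha> \<longleftrightarrow> padic_norm x = \<alpha>"
  by (induction n) (simp_all add: norm_inv_square_map_eq_iff)

lemma fixed_point_iff: "z \<noteq> 0 \<and> f z = z \<longleftrightarrow> z ^ 3 = a"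
  using a_nz by (auto simp: inv_square_map_def field_simps power3_eq_cube power2_eq_square)

lemma norm_fixed_point:
  assumes "x0 ^ 3 = a"
  shows "padic_norm x0 = \<alpha>"
proof -
  have "x0 \<noteq> 0" "f x0 = x0" using assms fixed_point_iff by blast+
  then have "padic_norm x0 ^ 3 = \<alpha> ^ 3"
    using padic_norm_a padic_norm_power[of x0 3] assms by simp
  then show ?thesis
    using padic_norm_nonneg[of x0] \<alpha>_pos by (simp add: power_eq_iff_eq_base)
qed

lemma dist_inv_square_map:
  assumes x0: "x0 ^ 3 = a" and x: "padic_norm x = \<alpha>"
  shows "padic_norm (f x - x0) = padic_norm (x - x0) * padic_norm (x + x0) / \<alpha>"
proof -
  have "x \<noteq> 0" using x \<alpha>_pos padic_norm_eq_0_iff[of x] by auto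
  then have "f x - x0 = - (x0 * ((x - x0) * (x + x0)) / x ^ 2)"
    unfolding inv_square_map_def x0[symmetric]
    by (simp add: field_simps power3_eq_cube power2_eq_square)
  then have "padic_norm (f x - x0) = padic_norm (x0 * ((x - x0) * (x + x0)) / x ^ 2)"
    by (simp only: padic_norm_minus)
  also have "\<dots> = \<alpha> * (padic_norm (x - x0) * padic_norm (x + x0)) / \<alpha> ^ 2"
    by (simp only: padic_norm_divide padic_norm_mult padic_norm_power x norm_fixed_point[OF x0])
  also have "\<dots> = padic_norm (x - x0) * padic_norm (x + x0) / \<alpha>"
    using \<alpha>_pos by (simp add: power2_eq_square)
  finally show ?thesis .
qed

lemma dist_fixed_point_le:
  assumes "x0 ^ 3 = a" and "padic_norm x = \<alpha>"
  shows "padic_norm (x - x0) \<le> \<alpha>"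
  using padic_norm_diff_le[of x x0] norm_fixed_point assms by simp

lemma norm_near_fixed_point:
  assumes "x0 ^ 3 = a" and "padic_norm (x - x0) < \<alpha>"
  shows "padic_norm x = \<alpha>"
  using padic_norm_add_dominant[of "x - x0" x0] norm_fixed_point assms by simp

lemma disc_at_eq_ball:
  assumes "x0 ^ 3 = a"
  shows "disc_at \<alpha> \<alpha> x0 = ball x0 \<alpha>"
proof (rule set_eqI)
  fix x
  show "x \<in> disc_at \<alpha> \<alpha> x0 \<longleftrightarrow> x \<in> ball x0 \<alpha>"
    using norm_near_fixed_point[OF assms, of x]
    by (auto simp: mem_disc_at_iff dist_eq_padic_norm padic_norm_diff_commute[of x0])
qed

text \<open>
  Cancelling \<open>y - z\<close> in \<open>y^3 - z^3 = 0\<close> leaves \<open>y^2 + y z + z^2 = 0\<close>, that is, \<open>(y - z)^2 = - 3 y z\<close>.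
\<close>
lemma dist_fixed_points:
  assumes y: "y ^ 3 = a" and z: "z ^ 3 = a" and "y \<noteq> z"
  shows "padic_norm (y - z) ^ 2 = padic_norm (of_nat 3 :: 'a) * \<alpha> ^ 2"
proof -
  have "(y - z) * ((y - z) ^ 2 + 3 * (y * z)) = y ^ 3 - z ^ 3"
    by (simp add: algebra_simps power3_eq_cube power2_eq_square)
  then have "(y - z) ^ 2 + 3 * (y * z) = 0"
    using y z \<open>y \<noteq> z\<close> by simp
  then have "(y - z) ^ 2 = - (of_nat 3 * (y * z))"
    by (simp add: eq_neg_iff_add_eq_0)
  then have "padic_norm ((y - z) ^ 2) = padic_norm (of_nat 3 * (y * z))"
    by (metis padic_norm_minus)
  then show ?thesis
    using norm_fixed_point[OF y] norm_fixed_point[OF z]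
    by (simp add: padic_norm_power padic_norm_mult power2_eq_square)
qed

section \<open>The even prime: attracting fixed points\<close>

lemma norm_double_fixed_point:
  assumes "p = 2" and "x0 ^ 3 = a"
  shows "padic_norm (2 * x0) = \<alpha> / 2"
  using padic_norm_p[OF field] assms norm_fixed_point by (simp add: padic_norm_mult)

text \<open>
  A bound \<open>c \<ge> 1/2\<close> on \<open>\<bar>x - x0\<bar> / \<alpha>\<close> is also a contraction factor. It is kept fixed instead of being
  recomputed at each point, so that it can be iterated.
\<close>
lemma even_contraction:
  assumes p: "p = 2" and x0: "x0 ^ 3 = a" and x: "padic_norm x = \<alpha>"
    and c: "1 / 2 \<le> c" and le: "padic_norm (x - x0) \<le> c * \<alpha>"
  shows "padic_norm (f x - x0) \<le> c * padic_norm (x - x0)"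
proof -
  have "padic_norm (x + x0) \<le> max (padic_norm (x - x0)) (padic_norm (2 * x0))"
    using padic_norm_add_le[of "x - x0" "2 * x0"] by (simp add: algebra_simps)
  also have "\<dots> \<le> c * \<alpha>"
    unfolding norm_double_fixed_point[OF p x0]
    using le c \<alpha>_pos mult_right_mono[of "1/2" c \<alpha>] by simp
  finally have "padic_norm (x - x0) * padic_norm (x + x0) \<le> padic_norm (x - x0) * (c * \<alpha>)"
    by (intro mult_left_mono padic_norm_nonneg)
  then show ?thesis
    using \<alpha>_pos by (simp add: dist_inv_square_map[OF x0 x] field_simps)
qed

lemma even_orbit_tendsto:
  assumes p: "p = 2" and x0: "x0 ^ 3 = a" and near: "padic_norm (x - x0) < \<alpha>"
  shows "(\<lambda>n. (f ^^ n) x) \<longlonglongrightarrow> x0"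
proof -
  define c where "c = max (padic_norm (x - x0) / \<alpha>) (1 / 2)"
  have c: "1 / 2 \<le> c" "c < 1" "padic_norm (x - x0) \<le> c * \<alpha>"
    using near \<alpha>_pos by (auto simp: c_def field_simps max_def)
  have x: "padic_norm ((f ^^ n) x) = \<alpha>" for n
    using norm_near_fixed_point[OF x0 near] norm_orbit_eq_iff by blast
  have bound: "padic_norm ((f ^^ n) x - x0) \<le> c ^ n * (c * \<alpha>)" for n
  proof (induction n)
    case 0
    show ?case using c by simp
  next
    case (Suc n)
    have "c ^ n * (c * \<alpha>) \<le> 1 * (c * \<alpha>)"
      using c \<alpha>_pos by (intro mult_right_mono power_le_one) auto
    then have "padic_norm ((f ^^ n) x - x0) \<le> c * \<alpha>"
      using Suc.IH by linarith
    then have "padic_norm (f ((f ^^ n) x) - x0) \<le> c * padic_norm ((f ^^ n) x - x0)"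
      using even_contraction[OF p x0 x c(1)] by blast
    also have "\<dots> \<le> c * (c ^ n * (c * \<alpha>))"
      using c Suc.IH by (intro mult_left_mono) auto
    finally show ?case by (simp add: mult.assoc)
  qed
  have "(\<lambda>n. c ^ n * (c * \<alpha>)) \<longlonglongrightarrow> 0 * (c * \<alpha>)"
    using c by (intro tendsto_mult tendsto_const LIMSEQ_power_zero) auto
  then have lim: "(\<lambda>n. c ^ n * (c * \<alpha>)) \<longlonglongrightarrow> 0" by simp
  have "(\<lambda>n. padic_norm ((f ^^ n) x - x0)) \<longlonglongrightarrow> 0"
    by (rule real_tendsto_sandwich[OF _ _ tendsto_const lim]) (simp_all add: bound padic_norm_nonneg)
  then show ?thesis
    by (subst tendsto_dist_iff) (simp add: dist_eq_padic_norm)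
qed

text \<open>
  At distance \<open>\<alpha>\<close> from \<open>x0\<close> the summand \<open>x - x0\<close> dominates \<open>2 x0\<close>, so the distance is multiplied by \<open>1\<close>.
\<close>
lemma even_far_step:
  assumes p: "p = 2" and x0: "x0 ^ 3 = a" and x: "padic_norm x = \<alpha>"
    and far: "padic_norm (x - x0) = \<alpha>"
  shows "padic_norm (f x - x0) = \<alpha>"
proof -
  have "padic_norm (2 * x0 + (x - x0)) = padic_norm (x - x0)"
    using far \<alpha>_pos norm_double_fixed_point[OF p x0] by (intro padic_norm_add_dominant) simp
  then have "padic_norm (x + x0) = \<alpha>"
    using far by (simp add: algebra_simps)
  then show ?thesis
    using \<alpha>_pos far by (simp add: dist_inv_square_map[OF x0 x])
qed

lemma even_far_orbit:
  assumes "p = 2" and "x0 ^ 3 = a" and "padic_norm x = \<alpha>" and "padic_norm (x - x0) = \<alpha>"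
  shows "padic_norm ((f ^^ n) x - x0) = \<alpha>"
  using assms by (induction n) (simp_all add: even_far_step norm_orbit_eq_iff)

lemma even_basin:
  assumes p: "p = 2" and x0: "x0 ^ 3 = a"
  shows "basin f x0 = disc_at \<alpha> \<alpha> x0"
proof (intro equalityI subsetI)
  fix x assume "x \<in> basin f x0"
  then have "(\<lambda>n. (f ^^ n) x) \<longlonglongrightarrow> x0" by (simp add: basin_def)
  then have "\<forall>\<^sub>F n in sequentially. dist ((f ^^ n) x) x0 < \<alpha>"
    using \<alpha>_pos by (rule tendstoD)
  then obtain n where n: "padic_norm ((f ^^ n) x - x0) < \<alpha>"
    using eventually_happens'[OF sequentially_bot] by (auto simp: dist_eq_padic_norm)
  then have x: "padic_norm x = \<alpha>"
    using norm_near_fixed_point[OF x0] norm_orbit_eq_iff by blast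
  then have "padic_norm (x - x0) \<noteq> \<alpha>"
    using n even_far_orbit[OF p x0, of x n] by auto
  then show "x \<in> disc_at \<alpha> \<alpha> x0"
    using x dist_fixed_point_le[OF x0 x] by (simp add: mem_disc_at_iff)
next
  fix x assume "x \<in> disc_at \<alpha> \<alpha> x0"
  then have "padic_norm x = \<alpha>" "padic_norm (x - x0) < \<alpha>"
    by (auto simp: mem_disc_at_iff)
  then show "x \<in> basin f x0"
    using even_orbit_tendsto[OF p x0] \<alpha>_pos padic_norm_eq_0_iff[of x] by (auto simp: basin_def)
qed

section \<open>Odd primes: Siegel disks\<close>

text \<open>
  As \<open>\<bar>2\<bar> = 1\<close>, the summand \<open>2 x0\<close> has absolute value \<open>\<alpha>\<close> and dominates \<open>x - x0\<close>, so \<open>f\<close> preserves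
  the distance to \<open>x0\<close>.
\<close>
lemma odd_near_step:
  assumes p: "p \<ge> 3" and x0: "x0 ^ 3 = a" and near: "padic_norm (x - x0) < \<alpha>"
  shows "padic_norm (f x - x0) = padic_norm (x - x0)"
proof -
  have "padic_norm (2 :: 'a) = 1"
    using padic_norm_prime_unit[of 2] p by simp
  then have "padic_norm (2 * x0) = \<alpha>"
    using norm_fixed_point[OF x0] by (simp add: padic_norm_mult)
  then have "padic_norm ((x - x0) + 2 * x0) = \<alpha>"
    using near padic_norm_add_dominant[of "x - x0" "2 * x0"] by simp
  then have "padic_norm (x + x0) = \<alpha>"
    by (simp add: algebra_simps)
  then show ?thesis
    using \<alpha>_pos dist_inv_square_map[OF x0 norm_near_fixed_point[OF x0 near]] by simp
qed

lemma odd_near_orbit: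
  assumes "p \<ge> 3" and "x0 ^ 3 = a" and "padic_norm (x - x0) < \<alpha>"
  shows "padic_norm ((f ^^ n) x - x0) = padic_norm (x - x0)"
  using assms by (induction n) (simp_all add: odd_near_step)

lemma odd_max_siegel_disk:
  assumes p: "p \<ge> 3" and x0: "x0 ^ 3 = a"
  shows "max_siegel_disk f x0 = disc_at \<alpha> \<alpha> x0"
proof -
  have fix_x0: "x0 \<noteq> 0" "f x0 = x0"
    using x0 fixed_point_iff by blast+
  have dist_0: "dist x0 0 = \<alpha>"
    using norm_fixed_point[OF x0] by (simp add: padic_norm_def)
  have "siegel_disk f x0 (ball x0 \<alpha>)"
    unfolding siegel_disk_def
  proof (intro conjI exI[of _ \<alpha>] allI impI ballI)
    show "ball x0 \<alpha> \<subseteq> UNIV - {0}" using dist_0 by auto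
    fix \<rho> x and n :: nat assume "\<rho> < \<alpha>" "x \<in> sphere x0 \<rho>"
    then show "(f ^^ n) x \<in> sphere x0 \<rho>"
      using odd_near_orbit[OF p x0, of x n]
      by (simp add: mem_sphere_iff del: mem_sphere)
  qed (use fix_x0 \<alpha>_pos in auto)
  moreover have "D \<subseteq> ball x0 \<alpha>" if siegel: "siegel_disk f x0 D" for D
  proof -
    obtain r where r: "D = ball x0 r" "0 \<notin> D"
      using siegel unfolding siegel_disk_def by blast
    then have "r \<le> \<alpha>" using dist_0 by simp
    then show ?thesis using r by (simp add: subset_ball)
  qed
  ultimately have "\<Union> {D. siegel_disk f x0 D} = ball x0 \<alpha>"
    by (intro equalityI Union_least Union_upper) simp_all
  then show ?thesis
    by (simp add: max_siegel_disk_def disc_at_eq_ball[OF x0])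
qed

text \<open>For \<open>p = 3\<close> the centres are at distance less than \<open>\<alpha>\<close>, as \<open>\<bar>3\<bar> < 1\<close>.\<close>
lemma three_discs_equal:
  assumes p: "p = 3" and y: "y ^ 3 = a" and z: "z ^ 3 = a"
  shows "disc_at \<alpha> \<alpha> y = disc_at \<alpha> \<alpha> z"
proof (cases "y = z")
  case False
  have "padic_norm (y - z) ^ 2 < \<alpha> ^ 2"
    using dist_fixed_points[OF y z False] padic_norm_p[OF field] p \<alpha>_pos by simp
  then have close: "padic_norm (y - z) < \<alpha>"
    by (rule power_less_imp_less_base) (use \<alpha>_pos in simp)
  have "padic_norm (x - y) < \<alpha> \<longleftrightarrow> padic_norm (x - z) < \<alpha>" for x
    using close padic_norm_add_le[of "x - y" "y - z"] padic_norm_diff_le[of "x - z" "y - z"]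
    by auto
  then show ?thesis by (simp add: set_eq_iff mem_disc_at_iff)
qed simp

text \<open>For \<open>p > 3\<close> the centres are at distance exactly \<open>\<alpha>\<close>, as \<open>\<bar>3\<bar> = 1\<close>.\<close>
lemma large_prime_discs_disjoint:
  assumes p: "p > 3" and y: "y ^ 3 = a" and z: "z ^ 3 = a" and ne: "y \<noteq> z"
  shows "disc_at \<alpha> \<alpha> y \<inter> disc_at \<alpha> \<alpha> z = {}"
proof -
  have "padic_norm (of_nat 3 :: 'a) = 1"
    using p by (intro padic_norm_prime_unit) simp_all
  then have "padic_norm (y - z) ^ 2 = \<alpha> ^ 2"
    using dist_fixed_points[OF y z ne] by simp
  then have "padic_norm (y - z) = \<alpha>"
    using \<alpha>_pos padic_norm_nonneg[of "y - z"] by (simp add: power2_eq_iff_nonneg)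
  then have "\<not> (padic_norm (x - y) < \<alpha> \<and> padic_norm (x - z) < \<alpha>)" for x
    using padic_norm_diff_le[of "x - z" "x - y"] by auto
  then show ?thesis by (auto simp: mem_disc_at_iff)
qed

section \<open>The remote part\<close>

context
  fixes xs :: "nat \<Rightarrow> 'a"
  assumes roots: "\<And>j. j \<in> {1, 2, 3} \<Longrightarrow> xs j ^ 3 = a"
begin

lemma remote_part_iff:
  "x \<in> remote_part \<alpha> xs \<longleftrightarrow> padic_norm x = \<alpha> \<and> (\<forall>j\<in>{1, 2, 3}. padic_norm (x - xs j) = \<alpha>)"
  by (simp add: remote_part_def mem_sphere_0_iff del: mem_sphere)

lemma even_remote_orbit:
  assumes "p = 2" and "x \<in> remote_part \<alpha> xs"
  shows "(f ^^ n) x \<in> remote_part \<alpha> xs"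
  using assms even_far_orbit roots unfolding remote_part_iff norm_orbit_eq_iff by blast

text \<open>
  The dichotomy is about the first time at which the orbit is outside the remote part: before
  that time nothing is to be shown, and afterwards \<open>odd_near_orbit\<close> keeps the distance to the
  fixed point constant.
\<close>
lemma odd_remote_orbit:
  assumes p: "p \<ge> 3" and x: "x \<in> remote_part \<alpha> xs"
    and leaves: "\<not> (\<forall>n\<ge>1. (f ^^ n) x \<in> remote_part \<alpha> xs)"
  shows "\<exists>n0 \<mu>. \<exists>i\<in>{1, 2, 3}. 0 \<le> \<mu> \<and> \<mu> < \<alpha> \<and>
    (\<forall>n\<le>n0. (f ^^ n) x \<in> remote_part \<alpha> xs) \<and> (\<forall>n>n0. (f ^^ n) x \<in> sphere_at \<alpha> \<mu> (xs i))"
proof -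
  define out where "out n \<longleftrightarrow> (f ^^ n) x \<notin> remote_part \<alpha> xs" for n
  obtain n1 where out: "out n1" and before: "\<And>n. n < n1 \<Longrightarrow> \<not> out n"
    using leaves exists_least_iff[of out] unfolding out_def by blast
  obtain n0 where n1: "n1 = Suc n0"
    using out x unfolding out_def by (cases n1) auto
  define y where "y = (f ^^ n1) x"
  have norm: "padic_norm ((f ^^ n) x) = \<alpha>" for n
    using x by (simp add: remote_part_iff norm_orbit_eq_iff)
  obtain i where i: "i \<in> {1, 2, 3}" and "padic_norm (y - xs i) \<noteq> \<alpha>"
    using out norm unfolding out_def remote_part_iff y_def by blast
  then have near: "padic_norm (y - xs i) < \<alpha>"
    using dist_fixed_point_le[OF roots[OF i] norm, of n1] unfolding y_def by simp
  have "(f ^^ n) x \<in> sphere_at \<alpha> (padic_norm (y - xs i)) (xs i)" if "n > n0" for n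
  proof -
    have "(f ^^ n) x = (f ^^ (n - n1)) y"
      using that n1 funpow_add[of "n - n1" n1 f] unfolding y_def by simp
    then show ?thesis
      using odd_near_orbit[OF p roots[OF i] near, of "n - n1"] norm[of n]
      by (simp add: sphere_at_def mem_sphere_0_iff del: mem_sphere)
  qed
  moreover have "(f ^^ n) x \<in> remote_part \<alpha> xs" if "n \<le> n0" for n
    using before[of n] that n1 unfolding out_def by simp
  ultimately show ?thesis
    using i near padic_norm_nonneg by blast
qed

end

end

end

section \<open>The dynamics of the map\<close>

theorem theorem2:
  fixes p :: nat
    and a :: "'a::{field_char_0, complete_space}"
    and \<alpha> :: real
    and xs :: "nat \<Rightarrow> 'a"
  assumes "prime p"
    and "complex_padic_field p TYPE('a)"
    and "a \<noteq> 0"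
    and "\<alpha> = padic_norm a powr (1 / 3)"
    and "bij_betw xs {1, 2, 3} {z. z \<noteq> 0 \<and> inv_square_map a z = z}"
  shows
    "(p = 2 \<longrightarrow>
        (\<forall>j\<in>{1, 2, 3}.
           basin (inv_square_map a) (xs j) = disc_at \<alpha> \<alpha> (xs j) \<and>
           (\<forall>x\<in>disc_at \<alpha> \<alpha> (xs j). (\<lambda>n. (inv_square_map a ^^ n) x) \<longlonglongrightarrow> xs j)) \<and>
        (\<forall>x\<in>remote_part \<alpha> xs. \<forall>n\<ge>1. (inv_square_map a ^^ n) x \<in> remote_part \<alpha> xs)) \<and>
     (p \<ge> 3 \<longrightarrow>
        (\<forall>j\<in>{1, 2, 3}. max_siegel_disk (inv_square_map a) (xs j) = disc_at \<alpha> \<alpha> (xs j)) \<and>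
        (p = 3 \<longrightarrow>
           max_siegel_disk (inv_square_map a) (xs 1) = max_siegel_disk (inv_square_map a) (xs 2) \<and>
           max_siegel_disk (inv_square_map a) (xs 2) = max_siegel_disk (inv_square_map a) (xs 3)) \<and>
        (p > 3 \<longrightarrow>
           (\<forall>j\<in>{1, 2, 3}. \<forall>k\<in>{1, 2, 3}. j \<noteq> k \<longrightarrow>
              max_siegel_disk (inv_square_map a) (xs j) \<inter> max_siegel_disk (inv_square_map a) (xs k) = {}))) \<and>
     (p \<ge> 3 \<longrightarrow>
        (\<forall>x\<in>remote_part \<alpha> xs.
           (\<exists>n0::nat. \<exists>\<mu>::real. \<exists>i\<in>{1, 2, 3}. 0 \<le> \<mu> \<and> \<mu> < \<alpha> \<and>
              (\<forall>n\<le>n0. (inv_square_map a ^^ n) x \<in> remote_part \<alpha> xs) \<and>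
              (\<forall>n>n0. (inv_square_map a ^^ n) x \<in> sphere_at \<alpha> \<mu> (xs i))) \<or>
           (\<forall>n\<ge>1. (inv_square_map a ^^ n) x \<in> remote_part \<alpha> xs)))"
proof -
  note base = assms(2-4)
  have root: "xs j ^ 3 = a" if "j \<in> {1, 2, 3}" for j
    using bij_betwE[OF assms(5)] that fixed_point_iff[OF base] by blast
  have distinct: "xs j \<noteq> xs k" if "j \<in> {1, 2, 3}" "k \<in> {1, 2, 3}" "j \<noteq> k" for j k
    using inj_onD[OF bij_betw_imp_inj_on[OF assms(5)]] that by blast
  show ?thesis
  proof (intro conjI impI ballI allI)
    fix j assume p: "p = 2" and j: "j \<in> {1, 2, 3::nat}"
    show basin: "basin (inv_square_map a) (xs j) = disc_at \<alpha> \<alpha> (xs j)"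
      by (rule even_basin[OF base p root[OF j]])
    show "(\<lambda>n. (inv_square_map a ^^ n) x) \<longlonglongrightarrow> xs j" if "x \<in> disc_at \<alpha> \<alpha> (xs j)" for x
      using that unfolding basin[symmetric] by (simp add: basin_def)
  next
    fix x and n :: nat assume "p = 2" "x \<in> remote_part \<alpha> xs"
    then show "(inv_square_map a ^^ n) x \<in> remote_part \<alpha> xs"
      using even_remote_orbit[OF base, of xs] root by blast
  next
    fix j assume "p \<ge> 3" "j \<in> {1, 2, 3::nat}"
    then show "max_siegel_disk (inv_square_map a) (xs j) = disc_at \<alpha> \<alpha> (xs j)"
      using odd_max_siegel_disk[OF base] root by blast
  next
    assume p: "p = 3"
    have "max_siegel_disk (inv_square_map a) (xs j) = max_siegel_disk (inv_square_map a) (xs k)"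
      if "j \<in> {1, 2, 3}" "k \<in> {1, 2, 3}" for j k
    proof -
      have "p \<ge> 3" using p by simp
      then show ?thesis
        using three_discs_equal[OF base p root root, OF that]
        by (simp only: odd_max_siegel_disk[OF base _ root] that)
    qed
    from this[of 1 2] this[of 2 3] show
      "max_siegel_disk (inv_square_map a) (xs 1) = max_siegel_disk (inv_square_map a) (xs 2)"
      "max_siegel_disk (inv_square_map a) (xs 2) = max_siegel_disk (inv_square_map a) (xs 3)"
      by simp_all
  next
    fix j k assume "p > 3" and "j \<in> {1, 2, 3::nat}" "k \<in> {1, 2, 3::nat}" "j \<noteq> k"
    moreover from \<open>p > 3\<close> have "p \<ge> 3" by simp
    ultimately show
      "max_siegel_disk (inv_square_map a) (xs j) \<inter> max_siegel_disk (inv_square_map a) (xs k) = {}"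
      using large_prime_discs_disjoint[OF base _ root root distinct, of j k]
      by (simp only: odd_max_siegel_disk[OF base _ root] simp_thms)
  next
    fix x assume "p \<ge> 3" "x \<in> remote_part \<alpha> xs"
    then show "(\<exists>n0::nat. \<exists>\<mu>::real. \<exists>i\<in>{1, 2, 3}. 0 \<le> \<mu> \<and> \<mu> < \<alpha> \<and>
          (\<forall>n\<le>n0. (inv_square_map a ^^ n) x \<in> remote_part \<alpha> xs) \<and>
          (\<forall>n>n0. (inv_square_map a ^^ n) x \<in> sphere_at \<alpha> \<mu> (xs i))) \<or>
        (\<forall>n\<ge>1. (inv_square_map a ^^ n) x \<in> remote_part \<alpha> xs)"
      using odd_remote_orbit[OF base, of xs x] root by blast
  qed
qed

end
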